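(* Every rationally generic finite metric space can be reconstructed from its transition $q$-spectrum. That is, if $X$ and $X'$ are rationally generic finite metric spaces having the same transition $q$-spectrum, then $X$ and $X'$ are isometric.
   Context: Let $(X,d)$ be a finite metric space, $X=\{x_1,\dots,x_n\}$, $d_{ij}=d(x_i,x_j)$. Let $q$ be a formal parameter (equivalently, $q$ ranges over real numbers in $(0,1)$), let $Z(q)=(q^{d_{ij}})_{i,j}$ be the similarity matrix, and let $\pi_i=\sum_{j=1}^n q^{d_{ij}}$ be its $i$-th row sum. The row-stochastic transition similarity matrix is $P(q)=(q^{d_{ij}}/\pi_i)_{i,j}$. The transition $q$-spectrum of $X$ is the multiset of eigenvalues of $P(q)$. Two finite metric spaces have the same transition $q$-spectrum if these multisets agree for all $q\in(0,1)$; equivalently, the characteristic polynomials of $P(q)$ coincide. The space $X$ is called rationally generic if the numbers $d_{ij}$ $(1\le i<j\le n)$ are linearly independent over $\mathbb{Q}$. *)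

theory Defs
  imports
    "HOL-Analysis.Abstract_Metric_Spaces"
    "HOL-Computational_Algebra.Fundamental_Theorem_Algebra"
    "Jordan_Normal_Form.Char_Poly"
begin

text \<open>
  A finite metric space is given by its carrier and distance function in the sense of the locale
  \<^locale>\<open>Metric_space\<close>, together with an enumeration \<^term>\<open>xs\<close> of its points. The enumeration
  only serves to index the rows and columns of the matrices below; points are numbered from 0.
\<close>

definition finite_metric_space ::
    "'a set \<Rightarrow> ('a \<Rightarrow> 'a \<Rightarrow> real) \<Rightarrow> 'a list \<Rightarrow> bool" where
  "finite_metric_space X d xs \<longleftrightarrow> Metric_space X d \<and> distinct xs \<and> set xs = X"

definition similarity_matrix :: "('a \<Rightarrow> 'a \<Rightarrow> real) \<Rightarrow> 'a list \<Rightarrow> real \<Rightarrow> real mat" where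
  "similarity_matrix d xs q =
     mat (length xs) (length xs) (\<lambda>(i, j). q powr d (xs ! i) (xs ! j))"

definition row_sum :: "real mat \<Rightarrow> nat \<Rightarrow> real" where
  "row_sum A i = (\<Sum>j<dim_col A. A $$ (i, j))"

definition transition_matrix :: "('a \<Rightarrow> 'a \<Rightarrow> real) \<Rightarrow> 'a list \<Rightarrow> real \<Rightarrow> real mat" where
  "transition_matrix d xs q =
     (let Z = similarity_matrix d xs q
      in mat (length xs) (length xs) (\<lambda>(i, j). Z $$ (i, j) / row_sum Z i))"

text \<open>
  Eigenvalues are counted with algebraic multiplicity and taken in the complex numbers, so that
  the multiset of eigenvalues of an \<open>n \<times> n\<close> matrix always has \<open>n\<close> elements.
\<close>

definition eigenvalue_mset :: "real mat \<Rightarrow> complex multiset" where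
  "eigenvalue_mset A = proots (char_poly (map_mat complex_of_real A))"

definition transition_spectrum ::
    "('a \<Rightarrow> 'a \<Rightarrow> real) \<Rightarrow> 'a list \<Rightarrow> real \<Rightarrow> complex multiset" where
  "transition_spectrum d xs q = eigenvalue_mset (transition_matrix d xs q)"

definition same_transition_spectrum ::
    "('a \<Rightarrow> 'a \<Rightarrow> real) \<Rightarrow> 'a list \<Rightarrow> ('b \<Rightarrow> 'b \<Rightarrow> real) \<Rightarrow> 'b list \<Rightarrow> bool" where
  "same_transition_spectrum d xs d' xs' \<longleftrightarrow>
     (\<forall>q\<in>{0<..<1}. transition_spectrum d xs q = transition_spectrum d' xs' q)"

text \<open>
  Linear independence over the rationals is that of the family of distances indexed by the pairs
  \<open>i < j\<close>, not of its set of values; in particular these distances are pairwise distinct.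
\<close>

definition rationally_generic :: "('a \<Rightarrow> 'a \<Rightarrow> real) \<Rightarrow> 'a list \<Rightarrow> bool" where
  "rationally_generic d xs \<longleftrightarrow>
     (\<forall>c :: nat \<Rightarrow> nat \<Rightarrow> rat.
        (\<Sum>j<length xs. \<Sum>i<j. of_rat (c i j) * d (xs ! i) (xs ! j)) = 0 \<longrightarrow>
        (\<forall>j<length xs. \<forall>i<j. c i j = 0))"

definition isometric ::
    "'a set \<Rightarrow> ('a \<Rightarrow> 'a \<Rightarrow> real) \<Rightarrow> 'b set \<Rightarrow> ('b \<Rightarrow> 'b \<Rightarrow> real) \<Rightarrow> bool" where
  "isometric X d X' d' \<longleftrightarrow>
     (\<exists>f. bij_betw f X X' \<and> (\<forall>x\<in>X. \<forall>y\<in>X. d' (f x) (f y) = d x y))"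

end

(* Only the trace of P(q) is needed: it equals the sum over the points x of 1 / (1 + sum q^d(x,y)),
   y ranging over the other points. Expanding every summand as a geometric series gives a series in
   powers of q, whose coefficients are determined by its asymptotics as q tends to 0. A power q^e
   occurs exactly when e is a sum (with repetitions) of distances from one single point: by linear
   independence all contributions to q^e come from words of the same length, hence have the same
   sign and cannot cancel. So the spectrum determines the set S of these exponents. The distances
   are the nonzero elements of S that are not sums of two nonzero elements of S, and a set of
   distances lies in the star {d(x,y) : y ~= x} of some point x iff its sum is in S. Thus the
   stars, which form an antichain, are determined; with at least three points, distinct points have
   distinct stars, and two stars meet exactly in the distance of their centres. *)
theory Submission
  imports Defs "Jordan_Normal_Form.Schur_Decomposition"
begin

section \<open>Asymptotics of finite sums of real powers as q tends to 0\<close>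

text \<open>If some exponent below \<open>B\<close> had a nonzero coefficient, let \<open>m\<close>
  be the least exponent with nonzero coefficient. After division by \<open>q powr m\<close> the sum
  tends to \<open>c m\<close> as q tends to 0 from the right, while the bound tends to 0 because
  \<open>m < B\<close>.\<close>

lemma powr_sum_coeff_eq_0:
  fixes c :: "real \<Rightarrow> real"
  assumes fin: "finite F"
    and bound: "\<And>q. 0 < q \<Longrightarrow> q < 1 \<Longrightarrow> \<bar>\<Sum>e\<in>F. c e * q powr e\<bar> \<le> C * q powr B"
    and e: "e \<in> F" "e < B"
  shows "c e = 0"
proof (rule ccontr)
  assume "c e \<noteq> 0"
  define E where "E = {e \<in> F. c e \<noteq> 0}"
  define m where "m = Min E"
  have E: "finite E" "e \<in> E" using fin e \<open>c e \<noteq> 0\<close> by (auto simp: E_def)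
  then have "m \<in> E" and m_le: "\<And>x. x \<in> E \<Longrightarrow> m \<le> x"
    unfolding m_def by (auto intro: Min_in)
  then have m: "m \<in> F" "c m \<noteq> 0" "m < B" using e E by (force simp: E_def)+
  let ?g = "\<lambda>q. \<Sum>x\<in>F. c x * q powr (x - m)"
  have "((\<lambda>q. c x * q powr (x - m)) \<longlongrightarrow> (if x = m then c m else 0)) (at_right 0)"
    if "x \<in> F" for x
  proof -
    \<comment> \<open>By minimality of \<open>m\<close>, exponents below \<open>m\<close> have
      coefficient 0.\<close>
    consider "c x = 0" "x \<noteq> m" | "x = m" | "x > m"
      using m_le[of x] \<open>x \<in> F\<close> m by (fastforce simp: E_def less_le)
    then show ?thesis
    proof cases
      \<comment> \<open>Continuity would give the wrong limit here, since
        \<open>0 powr 0 = 0\<close>; the term is constant only for \<open>q > 0\<close>.\<close>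
      case 2
      have "eventually (\<lambda>q. c x * q powr (x - m) = c m) (at_right 0)"
        using eventually_at_right_less[of "0::real"] by eventually_elim (simp add: 2)
      then show ?thesis using 2 by (simp add: tendsto_eventually)
    next
      case 3
      have "((\<lambda>q. q powr (x - m)) \<longlongrightarrow> 0 powr (x - m)) (at_right 0)"
        using 3 by (intro tendsto_intros) (auto simp: eventually_at_filter)
      from tendsto_mult_left[OF this, of "c x"] 3 show ?thesis by simp
    qed simp
  qed
  then have "(?g \<longlongrightarrow> (\<Sum>x\<in>F. if x = m then c m else 0)) (at_right 0)" by (rule tendsto_sum)
  then have lim: "(?g \<longlongrightarrow> c m) (at_right 0)" using fin m by simp
  have "((\<lambda>q. C * q powr (B - m)) \<longlongrightarrow> C * 0 powr (B - m)) (at_right 0)"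
    using m by (intro tendsto_intros) (auto simp: eventually_at_filter)
  then have z: "((\<lambda>q. C * q powr (B - m)) \<longlongrightarrow> 0) (at_right 0)" by simp
  have "eventually (\<lambda>q. q \<in> {0<..<1}) (at_right (0::real))"
    by (rule eventually_at_right_real) simp
  then have "eventually (\<lambda>q. norm (?g q) \<le> C * q powr (B - m)) (at_right 0)"
  proof eventually_elim
    case (elim q)
    have "?g q = (\<Sum>x\<in>F. c x * q powr x) * q powr (-m)"
      by (simp add: sum_distrib_right mult.assoc powr_add[symmetric])
    then have "norm (?g q) = \<bar>\<Sum>x\<in>F. c x * q powr x\<bar> * q powr (-m)" by (simp add: abs_mult)
    also have "\<dots> \<le> (C * q powr B) * q powr (-m)"
      using elim by (intro mult_right_mono bound) auto
    also have "\<dots> = C * q powr (B - m)" by (simp add: mult.assoc powr_add[symmetric])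
    finally show ?case .
  qed
  from Lim_null_comparison[OF this z] have "(?g \<longlongrightarrow> 0) (at_right 0)" .
  with lim have "c m = 0" by (rule tendsto_unique[rotated]) simp
  with m show False by simp
qed

text \<open>Induction on \<open>k\<close>, splitting off the first letter of a word. Indexing by
  words instead of multisets avoids multinomial coefficients.\<close>

lemma sum_powr_power_eq_sum_lists:
  fixes A :: "real set"
  assumes "finite A" and "0 < q"
  shows "(\<Sum>a\<in>A. q powr a) ^ k = (\<Sum>w\<in>{w. set w \<subseteq> A \<and> length w = k}. q powr sum_list w)"
proof (induction k)
  case 0
  have "{w. set w \<subseteq> A \<and> length w = 0} = {[]}" by auto
  then show ?case using assms by simp
next
  case (Suc k)
  let ?L = "{w. set w \<subseteq> A \<and> length w = k}"
  have "{w. set w \<subseteq> A \<and> length w = Suc k} = (\<lambda>(a, w). a # w) ` (A \<times> ?L)"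
    by (force simp: length_Suc_conv)
  moreover have "inj_on (\<lambda>(a, w). a # w) (A \<times> ?L)" by (auto simp: inj_on_def)
  ultimately have "(\<Sum>w\<in>{w. set w \<subseteq> A \<and> length w = Suc k}. q powr sum_list w) =
      (\<Sum>(a, w)\<in>A \<times> ?L. q powr a * q powr sum_list w)"
    by (simp add: sum.reindex case_prod_unfold powr_add)
  also have "\<dots> = (\<Sum>a\<in>A. q powr a) * (\<Sum>w\<in>?L. q powr sum_list w)"
    by (simp add: sum_product sum.cartesian_product)
  finally show ?case using Suc.IH by simp
qed

definition words :: "'a set \<Rightarrow> nat \<Rightarrow> 'a list set" where
  "words A K = {w. set w \<subseteq> A \<and> length w < K}"

lemma finite_words: "finite A \<Longrightarrow> finite (words A K)"
  unfolding words_def by (rule finite_subset[OF _ finite_lists_length_le[of A K]]) auto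

text \<open>With \<open>s\<close> the sum over \<open>A\<close>, the words of length
  \<open>k\<close> contribute \<open>(-s) ^ k\<close>, so the signed sum is a truncated geometric
  series for \<open>1 / (1 + s)\<close>. The remainder is \<open>(-s) ^ K / (1 + s)\<close>, and
  \<open>q < 1\<close> gives \<open>s \<le> card A * q powr \<delta>\<close>.\<close>

lemma inverse_one_plus_powr_sum_approx:
  fixes A :: "real set"
  assumes fin: "finite A" and q: "0 < q" "q < 1" and \<delta>: "\<And>a. a \<in> A \<Longrightarrow> \<delta> \<le> a"
  shows "\<bar>1 / (1 + (\<Sum>a\<in>A. q powr a)) - (\<Sum>w\<in>words A K. (-1) ^ length w * q powr sum_list w)\<bar>
    \<le> real (card A) ^ K * q powr (real K * \<delta>)"
proof -
  define s where "s = (\<Sum>a\<in>A. q powr a)"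
  have s: "s \<ge> 0" unfolding s_def by (intro sum_nonneg) simp
  have "s \<le> (\<Sum>a\<in>A. q powr \<delta>)" unfolding s_def
    using q \<delta> by (intro sum_mono powr_mono') auto
  then have s_le: "s \<le> real (card A) * q powr \<delta>" by simp
  have "(\<Sum>w\<in>words A K. (-1) ^ length w * q powr sum_list w) =
     (\<Sum>k<K. \<Sum>w | w \<in> words A K \<and> length w = k. (-1) ^ length w * q powr sum_list w)"
    using finite_words[OF fin] by (intro sum.group[symmetric]) (auto simp: words_def)
  also have "\<dots> = (\<Sum>k<K. (-s) ^ k)"
  proof (rule sum.cong)
    fix k assume "k \<in> {..<K}"
    then have "{w \<in> words A K. length w = k} = {w. set w \<subseteq> A \<and> length w = k}"
      by (auto simp: words_def)
    then have "(\<Sum>w | w \<in> words A K \<and> length w = k. (-1) ^ length w * q powr sum_list w)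
        = (-1) ^ k * (\<Sum>w | set w \<subseteq> A \<and> length w = k. q powr sum_list w)"
      by (simp add: sum_distrib_left)
    also have "\<dots> = (-s) ^ k"
      using sum_powr_power_eq_sum_lists[OF fin q(1), of k] power_minus[of s k] by (simp add: s_def)
    finally show "(\<Sum>w | w \<in> words A K \<and> length w = k. (-1) ^ length w * q powr sum_list w) = (-s) ^ k" .
  qed simp
  also have "\<dots> = (1 - (-s) ^ K) / (1 + s)" using s by (simp add: sum_gp_strict)
  finally have "1 / (1 + s) - (\<Sum>w\<in>words A K. (-1) ^ length w * q powr sum_list w) = (-s) ^ K / (1 + s)"
    by (simp add: diff_divide_distrib)
  moreover have "\<bar>(-s) ^ K / (1 + s)\<bar> \<le> s ^ K"
    using s by (simp add: power_abs abs_mult divide_le_eq mult_le_cancel_left1)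
  moreover have "s ^ K \<le> (real (card A) * q powr \<delta>) ^ K" using s s_le by (rule power_mono[rotated])
  moreover have "\<dots> = real (card A) ^ K * q powr (real K * \<delta>)"
    using q by (simp add: power_mult_distrib powr_power mult.commute)
  ultimately show ?thesis unfolding s_def by linarith
qed

section \<open>Exponents of the expanded trace\<close>

text \<open>That is, \<open>D\<close> freely generates its additive monoid: the part of linear
  independence over the rationals that concerns coefficients in the natural numbers.\<close>

definition free_sums :: "real set \<Rightarrow> bool" where
  "free_sums D \<longleftrightarrow> (\<forall>M N. set_mset M \<subseteq> D \<longrightarrow> set_mset N \<subseteq> D \<longrightarrow> \<Sum>\<^sub># M = \<Sum>\<^sub># N \<longrightarrow> M = N)"

text \<open>The union over \<open>x\<close> of the additive monoids generated by the sets
  \<open>A x\<close>. It is in general not closed under addition, and this is what carries the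
  information about the individual stars.\<close>

definition star_sums :: "('i \<Rightarrow> real set) \<Rightarrow> 'i set \<Rightarrow> real set" where
  "star_sums A X = {\<Sum>\<^sub># M | M x. x \<in> X \<and> set_mset M \<subseteq> A x}"

text \<open>Freeness of the left family makes all words with sum \<open>e\<close> rearrangements of
  one multiset, so their signs agree and the left coefficient of \<open>q powr e\<close> is nonzero.
  Comparison of coefficients makes the right one nonzero too, which requires a word with sum
  \<open>e\<close> on the right.\<close>

lemma star_sums_subset:
  fixes A :: "'i \<Rightarrow> real set" and A' :: "'j \<Rightarrow> real set"
  assumes fin: "finite X" "\<And>x. x \<in> X \<Longrightarrow> finite (A x)"
    and fin': "finite X'" "\<And>x. x \<in> X' \<Longrightarrow> finite (A' x)"
    and pos: "\<And>x a. x \<in> X \<Longrightarrow> a \<in> A x \<Longrightarrow> 0 < a"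
    and pos': "\<And>x a. x \<in> X' \<Longrightarrow> a \<in> A' x \<Longrightarrow> 0 < a"
    and free: "free_sums (\<Union>x\<in>X. A x)"
    and eq: "\<And>q. 0 < q \<Longrightarrow> q < 1 \<Longrightarrow>
      (\<Sum>x\<in>X. 1 / (1 + (\<Sum>a\<in>A x. q powr a))) = (\<Sum>x\<in>X'. 1 / (1 + (\<Sum>a\<in>A' x. q powr a)))"
  shows "star_sums A X \<subseteq> star_sums A' X'"
proof
  fix e assume "e \<in> star_sums A X"
  then obtain M x0 where M: "e = \<Sum>\<^sub># M" "x0 \<in> X" "set_mset M \<subseteq> A x0" by (auto simp: star_sums_def)
  \<comment> \<open>A positive lower bound for all letters on both sides; inserting 1 keeps the set
    nonempty.\<close>
  define \<delta> where "\<delta> = Min (insert 1 ((\<Union>x\<in>X. A x) \<union> (\<Union>x\<in>X'. A' x)))"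
  have fD: "finite (insert 1 ((\<Union>x\<in>X. A x) \<union> (\<Union>x\<in>X'. A' x)))" using fin fin' by auto
  have \<delta>: "\<delta> > 0" unfolding \<delta>_def using fD pos pos' by (subst Min_gr_iff) auto
  have \<delta>_le: "\<delta> \<le> a" if "x \<in> X" "a \<in> A x" for x a
    unfolding \<delta>_def using fD that by (intro Min_le) auto
  have \<delta>_le': "\<delta> \<le> a" if "x \<in> X'" "a \<in> A' x" for x a
    unfolding \<delta>_def using fD that by (intro Min_le) auto
  obtain K1 where K1: "e < real K1 * \<delta>" using reals_Archimedean3[OF \<delta>] by blast
  \<comment> \<open>The first bound pushes the truncation error beyond the order \<open>e\<close>;
    the second keeps the words representing \<open>M\<close> among those of length less than
    \<open>K\<close>.\<close>
  define K where "K = max K1 (Suc (size M))"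
  have "real K1 * \<delta> \<le> real K * \<delta>" using \<delta> by (simp add: K_def)
  with K1 have eK: "e < real K * \<delta>" by linarith
  have sizeK: "size M < K" by (simp add: K_def)
  define W where "W = (SIGMA x:X. words (A x) K)"
  define W' where "W' = (SIGMA x:X'. words (A' x) K)"
  have fW: "finite W" "finite W'" unfolding W_def W'_def using fin fin'
    by (auto intro!: finite_SigmaI finite_words)
  define F where "F = (sum_list \<circ> snd) ` W \<union> (sum_list \<circ> snd) ` W'"
  have fF: "finite F" using fW by (simp add: F_def)
  define c where "c e = (\<Sum>p | p \<in> W \<and> sum_list (snd p) = e. (-1 :: real) ^ length (snd p))" for e
  define c' where "c' e = (\<Sum>p | p \<in> W' \<and> sum_list (snd p) = e. (-1 :: real) ^ length (snd p))" for e
  \<comment> \<open>Collects words by exponent. The index type \<open>'k\<close> is left general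
    because the fact is applied to both \<open>W\<close> and \<open>W'\<close>.\<close>
  have group: "(\<Sum>e\<in>F. (\<Sum>p | p \<in> V \<and> sum_list (snd p) = e. (-1 :: real) ^ length (snd p)) * q powr e)
      = (\<Sum>p\<in>V. (-1) ^ length (snd p) * q powr sum_list (snd p))"
    if "finite V" "(sum_list \<circ> snd) ` V \<subseteq> F" for V :: "('k \<times> real list) set" and q :: real
  proof -
    have "(\<Sum>e\<in>F. (\<Sum>p | p \<in> V \<and> sum_list (snd p) = e. (-1 :: real) ^ length (snd p)) * q powr e)
      = (\<Sum>e\<in>F. (\<Sum>p | p \<in> V \<and> (sum_list \<circ> snd) p = e. (-1) ^ length (snd p) * q powr sum_list (snd p)))"
      by (simp add: sum_distrib_right)
    also have "\<dots> = (\<Sum>p\<in>V. (-1) ^ length (snd p) * q powr sum_list (snd p))"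
      using that fF by (intro sum.group) auto
    finally show ?thesis .
  qed
  define C where "C = (\<Sum>x\<in>X. real (card (A x)) ^ K) + (\<Sum>x\<in>X'. real (card (A' x)) ^ K)"
  have bound: "\<bar>\<Sum>e\<in>F. (c e - c' e) * q powr e\<bar> \<le> C * q powr (real K * \<delta>)" if q: "0 < q" "q < 1" for q
  proof -
    let ?h = "\<lambda>w. (-1) ^ length w * q powr sum_list w"
    let ?f = "\<lambda>A. 1 / (1 + (\<Sum>a\<in>A. q powr a))"
    have "(\<Sum>e\<in>F. (c e - c' e) * q powr e) = (\<Sum>e\<in>F. c e * q powr e) - (\<Sum>e\<in>F. c' e * q powr e)"
      by (simp add: left_diff_distrib sum_subtractf)
    also have "(\<Sum>e\<in>F. c e * q powr e) = (\<Sum>p\<in>W. ?h (snd p))"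
      unfolding c_def using fW by (intro group) (auto simp: F_def)
    also have "\<dots> = (\<Sum>x\<in>X. \<Sum>w\<in>words (A x) K. ?h w)"
      unfolding W_def using fin by (subst sum.Sigma) (auto simp: finite_words case_prod_unfold)
    also have "(\<Sum>e\<in>F. c' e * q powr e) = (\<Sum>p\<in>W'. ?h (snd p))"
      unfolding c'_def using fW by (intro group) (auto simp: F_def)
    also have "\<dots> = (\<Sum>x\<in>X'. \<Sum>w\<in>words (A' x) K. ?h w)"
      unfolding W'_def using fin' by (subst sum.Sigma) (auto simp: finite_words case_prod_unfold)
    \<comment> \<open>The two exact sums agree by \<open>eq\<close>, so only the truncation errors
      remain.\<close>
    also have "(\<Sum>x\<in>X. \<Sum>w\<in>words (A x) K. ?h w) - (\<Sum>x\<in>X'. \<Sum>w\<in>words (A' x) K. ?h w)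
      = (\<Sum>x\<in>X'. ?f (A' x) - (\<Sum>w\<in>words (A' x) K. ?h w)) - (\<Sum>x\<in>X. ?f (A x) - (\<Sum>w\<in>words (A x) K. ?h w))"
      using eq[OF q] by (simp add: sum_subtractf)
    finally have "\<bar>\<Sum>e\<in>F. (c e - c' e) * q powr e\<bar> \<le>
        \<bar>\<Sum>x\<in>X'. ?f (A' x) - (\<Sum>w\<in>words (A' x) K. ?h w)\<bar> + \<bar>\<Sum>x\<in>X. ?f (A x) - (\<Sum>w\<in>words (A x) K. ?h w)\<bar>"
      by linarith
    also have "\<dots> \<le> (\<Sum>x\<in>X'. real (card (A' x)) ^ K * q powr (real K * \<delta>))
        + (\<Sum>x\<in>X. real (card (A x)) ^ K * q powr (real K * \<delta>))"
      using q fin fin' \<delta>_le \<delta>_le'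
      by (intro add_mono order_trans[OF sum_abs] sum_mono inverse_one_plus_powr_sum_approx) auto
    also have "\<dots> = C * q powr (real K * \<delta>)" by (simp add: C_def sum_distrib_right distrib_right)
    finally show ?thesis .
  qed
  obtain w0 where w0: "mset w0 = M" using ex_mset by blast
  have w0W: "(x0, w0) \<in> W" "sum_list w0 = e"
    using w0 M sizeK by (auto simp: W_def words_def sum_mset_sum_list[symmetric])
  then have eF: "e \<in> F" by (force simp: F_def)
  have "c e - c' e = 0" using powr_sum_coeff_eq_0[OF fF bound eF eK] by simp
  have len: "length (snd p) = size M" if "p \<in> W" "sum_list (snd p) = e" for p
  proof -
    have "set_mset (mset (snd p)) \<subseteq> (\<Union>x\<in>X. A x)" "set_mset M \<subseteq> (\<Union>x\<in>X. A x)"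
      using that M by (auto simp: W_def words_def)
    moreover have "\<Sum>\<^sub># (mset (snd p)) = \<Sum>\<^sub># M" using that M by (simp add: sum_mset_sum_list)
    ultimately have "mset (snd p) = M" using free unfolding free_sums_def by blast
    then show ?thesis by auto
  qed
  have "c e = (-1) ^ size M * real (card {p \<in> W. sum_list (snd p) = e})"
    unfolding c_def using len by simp
  moreover have "card {p \<in> W. sum_list (snd p) = e} \<noteq> 0" using w0W fW by auto
  ultimately have "c e \<noteq> 0" by simp
  with \<open>c e - c' e = 0\<close> have "c' e \<noteq> 0" by simp
  then have "{p \<in> W'. sum_list (snd p) = e} \<noteq> {}" unfolding c'_def by (metis sum.empty)
  then obtain x w where xw: "(x, w) \<in> W'" "sum_list w = e" by auto
  then have "x \<in> X'" "set_mset (mset w) \<subseteq> A' x" "e = \<Sum>\<^sub># (mset w)"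
    by (auto simp: W'_def words_def sum_mset_sum_list)
  then show "e \<in> star_sums A' X'" unfolding star_sums_def by blast
qed

section \<open>The trace as the sum of the eigenvalues\<close>

definition mat_trace :: "'a :: comm_monoid_add mat \<Rightarrow> 'a" where
  "mat_trace A = (\<Sum>i<dim_row A. A $$ (i, i))"

lemma mat_trace_mult_commute:
  fixes A B :: "'a :: comm_semiring_0 mat"
  assumes "A \<in> carrier_mat n m" "B \<in> carrier_mat m n"
  shows "mat_trace (A * B) = mat_trace (B * A)"
proof -
  have "mat_trace (A * B) = (\<Sum>i<n. \<Sum>j<m. A $$ (i, j) * B $$ (j, i))"
    using assms by (auto simp: mat_trace_def scalar_prod_def lessThan_atLeast0 intro!: sum.cong)
  also have "\<dots> = (\<Sum>j<m. \<Sum>i<n. A $$ (i, j) * B $$ (j, i))" by (rule sum.swap)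
  also have "\<dots> = mat_trace (B * A)"
    using assms by (auto simp: mat_trace_def scalar_prod_def lessThan_atLeast0 mult.commute intro!: sum.cong)
  finally show ?thesis .
qed

lemma mat_trace_similar:
  fixes A B :: "'a :: comm_ring_1 mat"
  assumes "similar_mat A B"
  shows "mat_trace A = mat_trace B"
proof -
  from similar_matD[OF assms] obtain n P Q where
    carr: "{A, B, P, Q} \<subseteq> carrier_mat n n" and PQ: "Q * P = 1\<^sub>m n" and AB: "A = P * B * Q" by auto
  have "mat_trace A = mat_trace (P * (B * Q))" unfolding AB using carr by (simp add: assoc_mult_mat[of _ n n _ n _ n])
  also have "\<dots> = mat_trace (B * Q * P)" using carr by (intro mat_trace_mult_commute[of _ n n]) auto
  also have "B * Q * P = B"
    using carr PQ right_mult_one_mat[of B n n] by (simp add: assoc_mult_mat[of _ n n _ n _ n])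
  finally show ?thesis .
qed

lemma sum_list_diag_mat: "A \<in> carrier_mat n n \<Longrightarrow> sum_list (diag_mat A) = mat_trace A"
  by (auto simp: diag_mat_def mat_trace_def interv_sum_list_conv_sum_set_nat lessThan_atLeast0)

text \<open>The characteristic polynomial splits over the complex numbers, so Schur decomposition
  yields a similar upper triangular matrix. Its diagonal lists the roots with multiplicity, and
  similarity preserves the trace.\<close>

lemma sum_mset_proots_char_poly:
  fixes A :: "complex mat"
  assumes A: "A \<in> carrier_mat n n"
  shows "\<Sum>\<^sub># (proots (char_poly A)) = mat_trace A"
proof -
  obtain es where "char_poly A = (\<Prod>a\<leftarrow>es. [:- a, 1:])" using char_poly_factorized[OF A] by blast
  from schur_decomposition_exists[OF A this] obtain B where
    B: "B \<in> carrier_mat n n" "upper_triangular B" "similar_mat A B" by blast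
  have "char_poly A = (\<Prod>a\<leftarrow>diag_mat B. [:- a, 1:])"
    using char_poly_similar[OF B(3)] char_poly_upper_triangular[OF B(1,2)] by simp
  moreover have "proots (\<Prod>a\<leftarrow>bs. [:- a, 1:]) = mset bs" for bs :: "complex list"
  proof (induction bs)
    case (Cons b bs)
    have "(\<Prod>a\<leftarrow>bs. [:- a, 1:]) \<noteq> 0" by (auto simp: prod_list_zero_iff)
    with Cons show ?case by (simp add: proots_mult del: mult_pCons_left)
  qed simp
  ultimately have "\<Sum>\<^sub># (proots (char_poly A)) = sum_list (diag_mat B)" by (simp add: sum_mset_sum_list)
  also have "\<dots> = mat_trace A" using sum_list_diag_mat[OF B(1)] mat_trace_similar[OF B(3)] by simp
  finally show ?thesis .
qed

lemma sum_mset_eigenvalue_mset: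
  assumes "A \<in> carrier_mat n n"
  shows "\<Sum>\<^sub># (eigenvalue_mset A) = complex_of_real (mat_trace A)"
proof -
  have "map_mat complex_of_real A \<in> carrier_mat n n" using assms by simp
  from sum_mset_proots_char_poly[OF this] assms show ?thesis
    by (simp add: eigenvalue_mset_def mat_trace_def)
qed

section \<open>Stars and the trace of the transition matrix\<close>

definition star :: "('a \<Rightarrow> 'a \<Rightarrow> real) \<Rightarrow> 'a set \<Rightarrow> 'a \<Rightarrow> real set" where
  "star d X x = d x ` (X - {x})"

text \<open>The consequence of genericity that suffices for the geometry of stars, freed from the
  enumeration of the points.\<close>

definition edge_injective :: "'a set \<Rightarrow> ('a \<Rightarrow> 'a \<Rightarrow> real) \<Rightarrow> bool" where
  "edge_injective X d \<longleftrightarrow> (\<forall>x\<in>X. \<forall>y\<in>X. \<forall>u\<in>X. \<forall>v\<in>X.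
     x \<noteq> y \<longrightarrow> u \<noteq> v \<longrightarrow> d x y = d u v \<longrightarrow> {x, y} = {u, v})"

text \<open>The diagonal entry at \<open>x\<close> is the reciprocal of its row sum, in which the
  point \<open>x\<close> itself contributes \<open>q powr 0 = 1\<close>. Distances from
  \<open>x\<close> to the other points are distinct, so the sum over these points is a sum over the
  set \<open>star d X x\<close>.\<close>

lemma mat_trace_transition_matrix:
  assumes fms: "finite_metric_space X d xs" and inj: "edge_injective X d" and q: "0 < q"
  shows "mat_trace (transition_matrix d xs q) = (\<Sum>x\<in>X. 1 / (1 + (\<Sum>a\<in>star d X x. q powr a)))"
proof -
  interpret Metric_space X d using fms by (simp add: finite_metric_space_def)
  have xs: "distinct xs" "set xs = X" using fms by (auto simp: finite_metric_space_def)
  have bij: "bij_betw ((!) xs) {..<length xs} X" using xs by (intro bij_betw_nth) auto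
  have "mat_trace (transition_matrix d xs q) =
    (\<Sum>i<length xs. 1 / (\<Sum>j<length xs. q powr d (xs ! i) (xs ! j)))"
    using xs q by (auto simp: mat_trace_def transition_matrix_def Let_def similarity_matrix_def row_sum_def
        intro!: sum.cong)
  also have "\<dots> = (\<Sum>x\<in>X. 1 / (\<Sum>y\<in>X. q powr d x y))"
    by (simp add: sum.reindex_bij_betw[OF bij, symmetric])
  also have "\<dots> = (\<Sum>x\<in>X. 1 / (1 + (\<Sum>a\<in>star d X x. q powr a)))"
  proof (rule sum.cong)
    fix x assume x: "x \<in> X"
    have "finite X" using xs by auto
    then have "(\<Sum>y\<in>X. q powr d x y) = 1 + (\<Sum>y\<in>X - {x}. q powr d x y)"
      using x q by (subst sum.remove[of _ x]) auto
    moreover have "inj_on (d x) (X - {x})"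
      using inj x unfolding edge_injective_def inj_on_def by (metis DiffE doubleton_eq_iff singletonI)
    ultimately show "1 / (\<Sum>y\<in>X. q powr d x y) = 1 / (1 + (\<Sum>a\<in>star d X x. q powr a))"
      by (simp add: star_def sum.reindex)
  qed simp
  finally show ?thesis .
qed

lemma obtain_edge:
  assumes fms: "finite_metric_space X d xs" and xy: "x \<in> X" "y \<in> X" "x \<noteq> y"
  obtains i j where "i < j" "j < length xs" "{x, y} = {xs ! i, xs ! j}" "d x y = d (xs ! i) (xs ! j)"
proof -
  interpret Metric_space X d using fms by (simp add: finite_metric_space_def)
  have "set xs = X" using fms by (simp add: finite_metric_space_def)
  then obtain i j where ij: "i < length xs" "j < length xs" "x = xs ! i" "y = xs ! j"
    using xy by (metis in_set_conv_nth)
  with xy have "i \<noteq> j" by auto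
  then consider "i < j" | "j < i" by linarith
  then show thesis
  proof cases
    case 1
    with ij show thesis by (intro that[of i j]) auto
  next
    case 2
    with ij show thesis by (intro that[of j i]) (auto simp: commute)
  qed
qed

section \<open>Consequences of rational genericity\<close>

text \<open>The larger index comes first, matching the nesting of the double sum in
  \<open>rationally_generic\<close>.\<close>

abbreviation index_pairs :: "nat \<Rightarrow> (nat \<times> nat) set" where
  "index_pairs n \<equiv> (SIGMA j:{..<n}. {..<j})"

abbreviation edge_length :: "('a \<Rightarrow> 'a \<Rightarrow> real) \<Rightarrow> 'a list \<Rightarrow> nat \<times> nat \<Rightarrow> real" where
  "edge_length d xs p \<equiv> d (xs ! snd p) (xs ! fst p)"

lemma rationally_generic_pairs:
  assumes "rationally_generic d xs"
    and "(\<Sum>p\<in>index_pairs (length xs). of_rat (c p) * edge_length d xs p) = 0"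
    and "p \<in> index_pairs (length xs)"
  shows "c p = 0"
proof -
  have "(\<Sum>j<length xs. \<Sum>i<j. of_rat (c (j, i)) * d (xs ! i) (xs ! j)) = 0"
    using assms(2) by (subst sum.Sigma) (auto simp: case_prod_unfold)
  then have "\<forall>j<length xs. \<forall>i<j. c (j, i) = 0"
    using assms(1)[unfolded rationally_generic_def, rule_format, of "\<lambda>i j. c (j, i)"] by blast
  then show ?thesis using assms(3) by auto
qed

text \<open>Two equal distances at different index pairs would give a vanishing combination with
  coefficients 1 and -1.\<close>

lemma rationally_generic_inj_on:
  assumes gen: "rationally_generic d xs"
  shows "inj_on (edge_length d xs) (index_pairs (length xs))"
proof (rule inj_onI, rule ccontr)
  let ?P = "index_pairs (length xs)" and ?g = "edge_length d xs"
  fix p p' assume p: "p \<in> ?P" and p': "p' \<in> ?P" and eq: "?g p = ?g p'" and ne: "p \<noteq> p'"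
  define c :: "nat \<times> nat \<Rightarrow> rat" where
    "c = (\<lambda>r. if r = p then 1 else if r = p' then -1 else 0)"
  have "(\<Sum>r\<in>?P. of_rat (c r) * ?g r) =
      (\<Sum>r\<in>?P. (if r = p then ?g p else 0) - (if r = p' then ?g p' else 0))"
    using ne by (intro sum.cong) (auto simp: c_def)
  also have "\<dots> = ?g p - ?g p'" using p p' by (subst sum_subtractf) auto
  finally have "c p = 0" using eq p by (intro rationally_generic_pairs[OF gen]) auto
  then show False by (simp add: c_def)
qed

lemma rationally_generic_edge_injective:
  assumes fms: "finite_metric_space X d xs" and gen: "rationally_generic d xs"
  shows "edge_injective X d"
  unfolding edge_injective_def
proof (intro ballI impI)
  fix x y u v assume xy: "x \<in> X" "y \<in> X" "x \<noteq> y" and uv: "u \<in> X" "v \<in> X" "u \<noteq> v" and eq: "d x y = d u v"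
  obtain i j where ij: "i < j" "j < length xs" "{x, y} = {xs ! i, xs ! j}" "d x y = d (xs ! i) (xs ! j)"
    using obtain_edge[OF fms xy] .
  obtain k l where kl: "k < l" "l < length xs" "{u, v} = {xs ! k, xs ! l}" "d u v = d (xs ! k) (xs ! l)"
    using obtain_edge[OF fms uv] .
  have "(j, i) = (l, k)"
    using eq ij kl by (intro inj_onD[OF rationally_generic_inj_on[OF gen]]) auto
  then show "{x, y} = {u, v}" using ij kl by simp
qed

lemma edge_length_image:
  assumes fms: "finite_metric_space X d xs"
  shows "edge_length d xs ` index_pairs (length xs) = (\<Union>x\<in>X. star d X x)"
proof (intro equalityI subsetI)
  have xs: "distinct xs" "set xs = X" using fms by (auto simp: finite_metric_space_def)
  fix a assume "a \<in> edge_length d xs ` index_pairs (length xs)"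
  then obtain i j where "a = d (xs ! i) (xs ! j)" "i < j" "j < length xs" by auto
  moreover from this have "xs ! i \<noteq> xs ! j" "xs ! i \<in> X" "xs ! j \<in> X"
    using xs by (auto simp: nth_eq_iff_index_eq)
  ultimately have "a \<in> star d X (xs ! i)" "xs ! i \<in> X" by (auto simp: star_def)
  then show "a \<in> (\<Union>x\<in>X. star d X x)" by blast
next
  fix a assume "a \<in> (\<Union>x\<in>X. star d X x)"
  then obtain x y where a: "a = d x y" "x \<in> X" "y \<in> X" "x \<noteq> y" by (auto simp: star_def)
  obtain i j where ij: "i < j" "j < length xs" "d x y = d (xs ! i) (xs ! j)"
    using obtain_edge[OF fms a(2-4)] .
  with a show "a \<in> edge_length d xs ` index_pairs (length xs)"
    by (intro image_eqI[of _ _ "(j, i)"]) auto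
qed

lemma sum_mset_eq_sum_count:
  fixes M :: "real multiset"
  assumes "finite D" and "set_mset M \<subseteq> D"
  shows "\<Sum>\<^sub># M = (\<Sum>a\<in>D. real (count M a) * a)"
  using assms(2)
proof (induction M)
  case (add x M)
  have "(\<Sum>a\<in>D. real (count (add_mset x M) a) * a)
    = (\<Sum>a\<in>D. real (count M a) * a + (if a = x then x else 0))"
    by (intro sum.cong) (auto simp: algebra_simps)
  also have "\<dots> = \<Sum>\<^sub># M + x" using add assms(1) by (simp add: sum.distrib)
  finally show ?case by simp
qed simp

text \<open>The differences of the multiplicities in \<open>M\<close> and \<open>N\<close> are
  rational coefficients of a vanishing combination of the distances, hence all 0.\<close>

lemma rationally_generic_free_sums:
  assumes fms: "finite_metric_space X d xs" and gen: "rationally_generic d xs"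
  shows "free_sums (\<Union>x\<in>X. star d X x)"
  unfolding free_sums_def
proof (intro allI impI)
  let ?D = "\<Union>x\<in>X. star d X x"
  let ?P = "index_pairs (length xs)" and ?g = "edge_length d xs"
  fix M N assume M: "set_mset M \<subseteq> ?D" and N: "set_mset N \<subseteq> ?D" and eq: "\<Sum>\<^sub># M = \<Sum>\<^sub># N"
  have bij: "bij_betw ?g ?P ?D"
    using rationally_generic_inj_on[OF gen] edge_length_image[OF fms] by (simp add: bij_betw_def)
  have finD: "finite ?D" using bij_betw_finite[OF bij] by auto
  define c :: "nat \<times> nat \<Rightarrow> rat" where
    "c = (\<lambda>r. of_nat (count M (?g r)) - of_nat (count N (?g r)))"
  have "(\<Sum>r\<in>?P. of_rat (c r) * ?g r) = (\<Sum>r\<in>?P. (real (count M (?g r)) - real (count N (?g r))) * ?g r)"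
    by (simp add: c_def of_rat_diff)
  also have "\<dots> = (\<Sum>a\<in>?D. (real (count M a) - real (count N a)) * a)"
    by (rule sum.reindex_bij_betw[OF bij])
  also have "\<dots> = \<Sum>\<^sub># M - \<Sum>\<^sub># N"
    by (simp add: sum_mset_eq_sum_count[OF finD M] sum_mset_eq_sum_count[OF finD N]
        left_diff_distrib sum_subtractf)
  finally have c0: "c r = 0" if "r \<in> ?P" for r
    using eq that by (intro rationally_generic_pairs[OF gen]) auto
  show "M = N"
  proof (rule multiset_eqI)
    fix a
    show "count M a = count N a"
    proof (cases "a \<in> ?D")
      case True
      then obtain r where "a = ?g r" "r \<in> ?P" unfolding edge_length_image[OF fms, symmetric] by (rule imageE)
      then show ?thesis using c0[of r] by (simp add: c_def)
    next
      case False
      then have "a \<notin># M" "a \<notin># N" using M N by auto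
      then show ?thesis by (simp add: not_in_iff)
    qed
  qed
qed

section \<open>Recovering the family of stars from its sums\<close>

lemma free_sumsD:
  assumes "free_sums D" "set_mset M \<subseteq> D" "set_mset N \<subseteq> D" "\<Sum>\<^sub># M = \<Sum>\<^sub># N"
  shows "M = N"
  using assms unfolding free_sums_def by blast

lemma free_sums_nonzero:
  assumes "free_sums D" "set_mset M \<subseteq> D" "M \<noteq> {#}"
  shows "\<Sum>\<^sub># M \<noteq> 0"
  using free_sumsD[OF assms(1,2), of "{#}"] assms(3) by auto

lemma star_sumsI: "x \<in> X \<Longrightarrow> set_mset M \<subseteq> A x \<Longrightarrow> \<Sum>\<^sub># M \<in> star_sums A X"
  unfolding star_sums_def by blast

text \<open>Since \<open>M\<close> is the only multiset over the union with its sum, membership of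
  that number tests whether the support of \<open>M\<close> fits into a single star.\<close>

lemma sum_mset_in_star_sums_iff:
  assumes free: "free_sums (\<Union>x\<in>X. A x)" and M: "set_mset M \<subseteq> (\<Union>x\<in>X. A x)"
  shows "\<Sum>\<^sub># M \<in> star_sums A X \<longleftrightarrow> (\<exists>x\<in>X. set_mset M \<subseteq> A x)"
proof
  assume "\<Sum>\<^sub># M \<in> star_sums A X"
  then obtain N x where N: "\<Sum>\<^sub># M = \<Sum>\<^sub># N" "x \<in> X" "set_mset N \<subseteq> A x" by (auto simp: star_sums_def)
  then have "M = N" using M by (intro free_sumsD[OF free]) auto
  then show "\<exists>x\<in>X. set_mset M \<subseteq> A x" using N by auto
qed (auto simp: star_sums_def)

text \<open>The indecomposable elements; both summands must themselves lie in
  \<open>S\<close>.\<close>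

definition atoms :: "real set \<Rightarrow> real set" where
  "atoms S = {e \<in> S - {0}. \<forall>s\<in>S - {0}. \<forall>t\<in>S - {0}. e \<noteq> s + t}"

text \<open>A sum of two nonzero elements uses at least two letters, so by uniqueness it is not a
  single letter. Conversely, a multiset with at least two letters splits into one letter and a
  nonempty rest, both supported in the same star.\<close>

lemma atoms_star_sums:
  assumes free: "free_sums (\<Union>x\<in>X. A x)"
  shows "atoms (star_sums A X) = (\<Union>x\<in>X. A x)"
proof (intro equalityI subsetI)
  fix e assume "e \<in> (\<Union>x\<in>X. A x)"
  then obtain x where x: "x \<in> X" "e \<in> A x" by auto
  then have "\<Sum>\<^sub># {#e#} \<in> star_sums A X" by (intro star_sumsI) auto
  moreover have "e \<noteq> 0" using free_sums_nonzero[OF free, of "{#e#}"] x by auto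
  moreover have False if "s \<in> star_sums A X" "t \<in> star_sums A X" "s \<noteq> 0" "t \<noteq> 0" "e = s + t" for s t
  proof -
    obtain M y where M: "s = \<Sum>\<^sub># M" "y \<in> X" "set_mset M \<subseteq> A y" using \<open>s \<in> _\<close> by (auto simp: star_sums_def)
    obtain N z where N: "t = \<Sum>\<^sub># N" "z \<in> X" "set_mset N \<subseteq> A z" using \<open>t \<in> _\<close> by (auto simp: star_sums_def)
    have "{#e#} = M + N" using x M N that by (intro free_sumsD[OF free]) auto
    then have "size M + size N = 1" by (metis size_union size_single)
    then have "M = {#} \<or> N = {#}" by (cases "size M") auto
    then show False using M N that by auto
  qed
  ultimately show "e \<in> atoms (star_sums A X)" by (auto simp: atoms_def)
next
  fix e assume e: "e \<in> atoms (star_sums A X)"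
  then obtain M x where M: "e = \<Sum>\<^sub># M" "x \<in> X" "set_mset M \<subseteq> A x" "e \<noteq> 0"
    by (auto simp: atoms_def star_sums_def)
  then obtain a N where aN: "M = add_mset a N" by (cases M) auto
  have "N = {#}"
  proof (rule ccontr)
    assume "N \<noteq> {#}"
    then have "\<Sum>\<^sub># N \<noteq> 0" "\<Sum>\<^sub># {#a#} \<noteq> 0"
      using M aN free_sums_nonzero[OF free, of N] free_sums_nonzero[OF free, of "{#a#}"] by (auto simp del: sum_mset.singleton)
    moreover have "set_mset N \<subseteq> A x" "set_mset {#a#} \<subseteq> A x" using M aN by auto
    then have "\<Sum>\<^sub># N \<in> star_sums A X" "\<Sum>\<^sub># {#a#} \<in> star_sums A X"
      using star_sumsI[where A = A, OF M(2)] by blast+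
    moreover have "e = \<Sum>\<^sub># {#a#} + \<Sum>\<^sub># N" using M aN by simp
    ultimately show False using e unfolding atoms_def by blast
  qed
  then show "e \<in> (\<Union>x\<in>X. A x)" using M aN by auto
qed

text \<open>Testing a whole star, each element taken once, on the other side and back gives
  \<open>A x \<subseteq> A' y \<subseteq> A z\<close>. The antichain property turns both inclusions
  into equalities.\<close>

lemma stars_subset_of_star_sums_eq:
  assumes free: "free_sums (\<Union>x\<in>X. A x)" and free': "free_sums (\<Union>x\<in>X'. A' x)"
    and fin: "\<And>x. x \<in> X \<Longrightarrow> finite (A x)" and fin': "\<And>x. x \<in> X' \<Longrightarrow> finite (A' x)"
    and antichain: "\<And>x y. x \<in> X \<Longrightarrow> y \<in> X \<Longrightarrow> A x \<subseteq> A y \<Longrightarrow> A x = A y"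
    and eq: "star_sums A X = star_sums A' X'"
  shows "A ` X \<subseteq> A' ` X'"
proof
  \<comment> \<open>Both unions are the atoms of the same set, so a star of either side is a
    legitimate test set for the other.\<close>
  have D: "(\<Union>x\<in>X. A x) = (\<Union>x\<in>X'. A' x)"
    using atoms_star_sums[OF free] atoms_star_sums[OF free'] eq by simp
  fix B assume "B \<in> A ` X"
  then obtain x where x: "x \<in> X" "B = A x" by auto
  have "set_mset (mset_set (A x)) \<subseteq> A x" using fin x by simp
  then have "\<Sum>\<^sub># (mset_set (A x)) \<in> star_sums A X" using x by (auto simp: star_sums_def)
  moreover have "A x \<subseteq> (\<Union>x\<in>X'. A' x)" unfolding D[symmetric] using x by blast
  ultimately have "\<exists>y\<in>X'. set_mset (mset_set (A x)) \<subseteq> A' y"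
    using sum_mset_in_star_sums_iff[OF free', of "mset_set (A x)"] eq x fin by simp
  then obtain y where y: "y \<in> X'" "A x \<subseteq> A' y" using fin x by auto
  have "set_mset (mset_set (A' y)) \<subseteq> A' y" using fin' y by simp
  then have "\<Sum>\<^sub># (mset_set (A' y)) \<in> star_sums A' X'" using y by (auto simp: star_sums_def)
  moreover have "A' y \<subseteq> (\<Union>x\<in>X. A x)" unfolding D using y by blast
  ultimately have "\<exists>z\<in>X. set_mset (mset_set (A' y)) \<subseteq> A z"
    using sum_mset_in_star_sums_iff[OF free, of "mset_set (A' y)"] eq y fin' by simp
  then obtain z where z: "z \<in> X" "A' y \<subseteq> A z" using fin' y by auto
  have "A x = A z" using antichain[of x z] x y z by blast
  then show "B \<in> A' ` X'" using x y z by blast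
qed

section \<open>Reconstructing the space from its stars\<close>

text \<open>A common value is the length of an edge at \<open>x\<close> and of an edge at
  \<open>y\<close>. By injectivity these are the same edge, which must join \<open>x\<close> and
  \<open>y\<close>.\<close>

lemma star_inter:
  assumes "Metric_space X d" "edge_injective X d" "x \<in> X" "y \<in> X" "x \<noteq> y"
  shows "star d X x \<inter> star d X y = {d x y}"
proof -
  interpret Metric_space X d by fact
  have "d x y \<in> star d X x" "d y x \<in> star d X y" using assms by (auto simp: star_def)
  then have "d x y \<in> star d X x \<inter> star d X y" by (simp add: commute)
  moreover have "a = d x y" if ax: "a \<in> star d X x" and ay: "a \<in> star d X y" for a
  proof -
    obtain u where u: "u \<in> X" "u \<noteq> x" "a = d x u" using ax unfolding star_def by blast
    obtain v where v: "v \<in> X" "v \<noteq> y" "a = d y v" using ay unfolding star_def by blast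
    from u v have "{x, u} = {y, v}" using assms unfolding edge_injective_def by metis
    then show ?thesis using u v assms by (auto simp: doubleton_eq_iff)
  qed
  ultimately show ?thesis by blast
qed

text \<open>For \<open>x \<noteq> y\<close> the inclusion would leave only \<open>d x y\<close> in
  the star of \<open>x\<close>, but that star has \<open>card X - 1\<close>, hence at least two,
  elements.\<close>

lemma star_subset_imp_eq:
  assumes ms: "Metric_space X d" and inj: "edge_injective X d" and fin: "finite X" and three: "card X \<ge> 3"
    and x: "x \<in> X" and y: "y \<in> X" and sub: "star d X x \<subseteq> star d X y"
  shows "x = y"
proof (rule ccontr)
  assume ne: "x \<noteq> y"
  have "star d X x = {d x y}" using star_inter[OF ms inj x y ne] sub by blast
  then have "card (d x ` (X - {x})) = 1" by (simp add: star_def)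
  moreover have "inj_on (d x) (X - {x})"
    using inj x unfolding edge_injective_def inj_on_def by (metis DiffE doubleton_eq_iff singletonI)
  ultimately have "card (X - {x}) = 1" by (simp add: card_image)
  then show False using fin x three by simp
qed

lemma card_le_2_cases:
  assumes "finite X" "card X < 3"
  obtains "X = {}" | x where "X = {x}" | x y where "X = {x, y}" "x \<noteq> y"
proof -
  have "card X = 0 \<or> card X = 1 \<or> card X = 2" using assms by linarith
  then show thesis using that assms by (auto simp: card_1_singleton_iff card_2_iff)
qed

lemma star_image_pair:
  assumes "x \<noteq> y" "d y x = d x y"
  shows "star d {x, y} ` {x, y} = {{d x y}}"
proof -
  have "{x, y} - {x} = {y}" "{x, y} - {y} = {x}" using assms by auto
  then show ?thesis using assms by (auto simp: star_def)
qed

text \<open>Equality is claimed for the stars and not for their centres, because the two points of a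
  two-point space share one star.\<close>

lemma star_antichain:
  assumes ms: "Metric_space X d" and inj: "edge_injective X d" and fin: "finite X"
    and x: "x \<in> X" and y: "y \<in> X" and sub: "star d X x \<subseteq> star d X y"
  shows "star d X x = star d X y"
proof (cases "card X < 3")
  case True
  interpret Metric_space X d by fact
  from fin True show ?thesis
  proof (cases rule: card_le_2_cases)
    case (3 u v)
    then have "X - {u} = {v}" "X - {v} = {u}" by auto
    then show ?thesis using 3 x y commute[of u v] by (auto simp: star_def)
  qed (use x y in auto)
next
  case False
  then show ?thesis using star_subset_imp_eq[OF ms inj fin _ x y sub] by simp
qed

text \<open>From three points on, points correspond to stars, and a distance is the only common
  element of two stars. Smaller spaces are treated directly, as the star map is not injective on two
  points.\<close>

lemma isometric_of_stars_eq:
  assumes ms: "Metric_space X d" and ms': "Metric_space X' d'" and fin: "finite X" "finite X'"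
    and inj: "edge_injective X d" and inj': "edge_injective X' d'"
    and eq: "star d X ` X = star d' X' ` X'"
  shows "isometric X d X' d'"
proof -
  interpret M: Metric_space X d by fact
  interpret M': Metric_space X' d' by fact
  show ?thesis
  proof (cases "card X < 3")
    case False
    then have three: "card X \<ge> 3" by simp
    have "card X = card (star d X ` X)"
      using star_subset_imp_eq[OF ms inj fin(1) three] by (intro card_image[symmetric] inj_onI) auto
    also have "\<dots> \<le> card X'" unfolding eq using fin by (rule_tac card_image_le)
    finally have three': "card X' \<ge> 3" using three by linarith
    have b: "bij_betw (star d X) X (star d X ` X)"
      using star_subset_imp_eq[OF ms inj fin(1) three] by (intro bij_betw_imageI inj_onI) auto
    have b': "bij_betw (star d' X') X' (star d X ` X)"
      using star_subset_imp_eq[OF ms' inj' fin(2) three'] unfolding eq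
      by (intro bij_betw_imageI inj_onI) auto
    \<comment> \<open>Sends \<open>x\<close> to the unique point of \<open>X'\<close> with the same
      star.\<close>
    define f where "f = inv_into X' (star d' X') \<circ> star d X"
    have f: "bij_betw f X X'"
      unfolding f_def by (rule bij_betw_trans[OF b bij_betw_inv_into[OF b']])
    have star_f: "star d' X' (f x) = star d X x" if "x \<in> X" for x
      using that eq unfolding f_def by (metis comp_apply f_inv_into_f image_eqI)
    have "d' (f x) (f y) = d x y" if xy: "x \<in> X" "y \<in> X" for x y
    proof (cases "x = y")
      case True
      then show ?thesis using bij_betwE[OF f] xy by simp
    next
      case False
      have "f x \<in> X'" "f y \<in> X'" "f x \<noteq> f y"
        using f xy False by (auto simp: bij_betw_def inj_on_def)
      then have "{d' (f x) (f y)} = star d' X' (f x) \<inter> star d' X' (f y)"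
        using star_inter[OF ms' inj'] by simp
      also have "\<dots> = {d x y}" using star_f xy star_inter[OF ms inj xy False] by simp
      finally show ?thesis by simp
    qed
    with f show ?thesis unfolding isometric_def by blast
  next
    case True
    \<comment> \<open>Three points in \<open>X'\<close> would have three distinct stars, more than
      \<open>X\<close> can supply.\<close>
    have "card X' < 3"
    proof (rule ccontr)
      assume *: "\<not> card X' < 3"
      have "card X' = card (star d' X' ` X')"
        using star_subset_imp_eq[OF ms' inj' fin(2)] * by (intro card_image[symmetric] inj_onI) auto
      also have "\<dots> \<le> card X" unfolding eq[symmetric] using fin by (rule_tac card_image_le)
      finally show False using * True by linarith
    qed
    from fin(1) True show ?thesis
    proof (cases rule: card_le_2_cases)
      case 1
      then show ?thesis using eq by (auto simp: isometric_def bij_betw_def)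
    next
      case (2 x)
      \<comment> \<open>An empty star identifies a one-point space; each star of a two-point space
        is a singleton.\<close>
      then have "star d' X' ` X' = {{}}" using eq by (simp add: star_def)
      moreover from fin(2) \<open>card X' < 3\<close> obtain x' where "X' = {x'}"
      proof (cases rule: card_le_2_cases)
        case (3 u v)
        then have "star d' X' u \<noteq> {}" by (auto simp: star_def)
        with 3 calculation show ?thesis by auto
      qed (use calculation in auto)
      ultimately show ?thesis using 2
        by (auto simp: isometric_def bij_betw_def intro!: exI[of _ "\<lambda>_. x'"])
    next
      case (3 x y)
      have img: "star d X ` X = {{d x y}}" unfolding 3(1)
        by (rule star_image_pair) (use 3 M.commute in auto)
      from fin(2) \<open>card X' < 3\<close> obtain x' y' where X': "X' = {x', y'}" "x' \<noteq> y'"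
      proof (cases rule: card_le_2_cases)
        case (2 u)
        then have "star d' X' ` X' = {{}}" by (simp add: star_def)
        with eq img show ?thesis by simp
      qed (use eq img in auto)
      have "star d' X' ` X' = {{d' x' y'}}" unfolding X'(1)
        by (rule star_image_pair) (use X' M'.commute in auto)
      with eq img have "d x y = d' x' y'" by simp
      then show ?thesis using 3 X' M.commute[of x y] M'.commute[of x' y']
        by (auto simp: isometric_def bij_betw_def inj_on_def
            intro!: exI[of _ "\<lambda>z. if z = x then x' else y'"])
    qed
  qed
qed

theorem theorem4p2:
  fixes X :: "'a set" and d :: "'a \<Rightarrow> 'a \<Rightarrow> real" and xs :: "'a list"
    and X' :: "'b set" and d' :: "'b \<Rightarrow> 'b \<Rightarrow> real" and xs' :: "'b list"
  assumes "finite_metric_space X d xs"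
    and "finite_metric_space X' d' xs'"
    and "rationally_generic d xs"
    and "rationally_generic d' xs'"
    and "same_transition_spectrum d xs d' xs'"
  shows "isometric X d X' d'"
proof -
  let ?A = "star d X" and ?A' = "star d' X'"
  have ms: "Metric_space X d" "Metric_space X' d'" and fin: "finite X" "finite X'"
    using assms(1,2) by (auto simp: finite_metric_space_def)
  interpret M: Metric_space X d by fact
  interpret M': Metric_space X' d' by fact
  note inj = rationally_generic_edge_injective[OF assms(1,3)]
  note inj' = rationally_generic_edge_injective[OF assms(2,4)]
  note free = rationally_generic_free_sums[OF assms(1,3)]
  note free' = rationally_generic_free_sums[OF assms(2,4)]
  have fin_star: "finite (?A x)" "finite (?A' y)" for x y using fin by (auto simp: star_def)
  have pos: "0 < a" if "x \<in> X" "a \<in> ?A x" for x a using that by (auto simp: star_def)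
  have pos': "0 < a" if "x \<in> X'" "a \<in> ?A' x" for x a using that by (auto simp: star_def)
  have traces: "(\<Sum>x\<in>X. 1 / (1 + (\<Sum>a\<in>?A x. q powr a))) = (\<Sum>x\<in>X'. 1 / (1 + (\<Sum>a\<in>?A' x. q powr a)))"
    if q: "0 < q" "q < 1" for q
  proof -
    \<comment> \<open>Equal spectra at \<open>q\<close> have equal sums of eigenvalues, that is,
      equal traces.\<close>
    have "complex_of_real (mat_trace (transition_matrix d xs q))
        = complex_of_real (mat_trace (transition_matrix d' xs' q))"
      using assms(5) q sum_mset_eigenvalue_mset[of "transition_matrix d xs q" "length xs"]
        sum_mset_eigenvalue_mset[of "transition_matrix d' xs' q" "length xs'"]
      by (simp add: same_transition_spectrum_def transition_spectrum_def transition_matrix_def Let_def)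
    then have "mat_trace (transition_matrix d xs q) = mat_trace (transition_matrix d' xs' q)"
      by (simp only: of_real_eq_iff)
    then show ?thesis
      using mat_trace_transition_matrix[OF assms(1) inj q(1)] mat_trace_transition_matrix[OF assms(2) inj' q(1)]
      by simp
  qed
  have "star_sums ?A X \<subseteq> star_sums ?A' X'"
    by (rule star_sums_subset) (use fin fin_star pos pos' free traces in auto)
  moreover have "star_sums ?A' X' \<subseteq> star_sums ?A X"
    by (rule star_sums_subset) (use fin fin_star pos pos' free' traces in auto)
  ultimately have eq: "star_sums ?A X = star_sums ?A' X'" by (rule equalityI)
  have "?A ` X \<subseteq> ?A' ` X'"
    by (rule stars_subset_of_star_sums_eq[OF free free' fin_star star_antichain[OF ms(1) inj fin(1)] eq])
  moreover have "?A' ` X' \<subseteq> ?A ` X"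
    by (rule stars_subset_of_star_sums_eq[OF free' free fin_star(2,1) star_antichain[OF ms(2) inj' fin(2)] eq[symmetric]])
  ultimately have "?A ` X = ?A' ` X'" by (rule equalityI)
  then show ?thesis by (rule isometric_of_stars_eq[OF ms fin inj inj'])
qed

end
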